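(* Let $G$ be a locally compact second countable group and $(X,\mu)$ a nonsingular $G$-space. The following are equivalent: $(X,\mu)$ is conservative; every $\mu$-positive Borel subset of $X$ is Poincaré recurrent; every $\mu$-positive Borel subset of $X$ is Poincaré Haar-recurrent.
   Context: Fix a left Haar measure $\lambda$ on $G$. A Borel $G$-space is a standard Borel space $X$ with a Borel action map $G\times X\to X$, $(g,x)\mapsto g.x$. A nonsingular $G$-space is a Borel $G$-space $X$ with a $\sigma$-finite Borel measure $\mu$ such that $\mu\circ g\sim\mu$ for all $g\in G$, where $(\mu\circ g)(A)=\mu(g.A)$. Its Radon--Nikodym cocycle is a Borel map $\nabla:G\times X\to\mathbb{R}_{>0}$ satisfying $\nabla_e(x)=1$, $\nabla_{gh}(x)=\nabla_g(h.x)\nabla_h(x)$ for all $g,h,x$, and $\nabla_g=\frac{d\mu\circ g}{d\mu}$ $\mu$-a.e. for each $g$. $L^1_+(X,\mu)$ is the class of everywhere strictly positive functions in $L^1(X,\mu)$, and $S_f^G(x)=\int_G\nabla_g(x)f(g.x)\,d\lambda(g)$. The Hopf decomposition is the essentially unique decomposition $X=\mathcal{C}\sqcup\mathcal{D}$ into $G$-invariant Borel sets such that for every $f\in L^1_+(X,\mu)$, modulo $\mu$, $\mathcal{C}=\{S_f^G=+\infty\}$ and $\mathcal{D}=\{S_f^G<+\infty\}$. $(X,\mu)$ is conservative if $\mu(\mathcal{D})=0$. A Borel set $A$ is $\mu$-positive if $\mu(A)>0$. A Borel set $A\subseteq X$ is Poincaré recurrent if for every compact set $K\subseteq G$ there is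 $g\in G\setminus K$ with $\mu(A\cap g.A)>0$. It is Poincaré Haar-recurrent if $\lambda(\{g\in G:\mu(A\cap g.A)>0\})=+\infty$. *)

theory Defs
  imports "HOL-Analysis.Analysis"
begin

text \<open>
  The group \<open>G\<close> is a type \<open>'g\<close>, and its operation is written additively, because the class
  \<^class>\<open>topological_group_add\<close> is the library's class of topological groups.  It extends
  \<^class>\<open>group_add\<close>, in which addition is not assumed to be commutative.  So \<open>g + h\<close>, \<open>0\<close>, \<open>- g\<close>
  stand for \<open>gh\<close>, \<open>e\<close>, \<open>g\<^sup>-\<^sup>1\<close>.

  The space \<open>X\<close> is the carrier \<^term>\<open>space M\<close> of a measure \<open>M\<close>, its Borel sets are \<^term>\<open>sets M\<close>,
  and the map \<open>act g x\<close> is only meaningful for \<open>x \<in> space M\<close>.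

  Haar measure is called \<open>\<eta>\<close>, and the Radon-Nikodym cocycle (usually written with a nabla)
  is called \<open>\<rho>\<close>.
\<close>

text \<open>
  No regularity is demanded of a Haar measure: on a second countable locally compact Hausdorff
  space every Borel measure that is finite on compact sets is regular.
\<close>

definition left_haar_measure ::
    "'g::{topological_group_add, t2_space, second_countable_topology} measure \<Rightarrow> bool"
  where "left_haar_measure \<eta> \<longleftrightarrow>
     sets \<eta> = sets borel \<and>
     (\<forall>K. compact K \<longrightarrow> emeasure \<eta> K < \<infinity>) \<and>
     emeasure \<eta> UNIV \<noteq> 0 \<and>
     (\<forall>g. \<forall>A\<in>sets borel. emeasure \<eta> ((\<lambda>h. g + h) ` A) = emeasure \<eta> A)"

definition standard_borel :: "'x measure \<Rightarrow> bool"
  where "standard_borel M \<longleftrightarrow>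
     (\<exists>T. completely_metrizable_space T \<and> second_countable T \<and> topspace T = space M \<and>
          sets M = sigma_sets (topspace T) {U. openin T U})"

definition borel_G_space ::
    "('g::{topological_group_add, t2_space, second_countable_topology} \<Rightarrow> 'x \<Rightarrow> 'x) \<Rightarrow>
     'x measure \<Rightarrow> bool"
  where "borel_G_space act M \<longleftrightarrow>
     standard_borel M \<and>
     (\<lambda>(g, x). act g x) \<in> borel \<Otimes>\<^sub>M M \<rightarrow>\<^sub>M M \<and>
     (\<forall>x\<in>space M. act 0 x = x) \<and>
     (\<forall>g h. \<forall>x\<in>space M. act (g + h) x = act g (act h x))"

text \<open>The measure \<open>\<mu> \<circ> g\<close>, that is, \<open>A \<mapsto> \<mu> (g.A)\<close>.\<close>

definition translate_measure :: "('g \<Rightarrow> 'x \<Rightarrow> 'x) \<Rightarrow> 'x measure \<Rightarrow> 'g \<Rightarrow> 'x measure"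
  where "translate_measure act M g =
     measure_of (space M) (sets M) (\<lambda>A. emeasure M (act g ` A))"

definition nonsingular_G_space ::
    "('g::{topological_group_add, t2_space, second_countable_topology} \<Rightarrow> 'x \<Rightarrow> 'x) \<Rightarrow>
     'x measure \<Rightarrow> bool"
  where "nonsingular_G_space act M \<longleftrightarrow>
     borel_G_space act M \<and> sigma_finite_measure M \<and>
     (\<forall>g. absolutely_continuous M (translate_measure act M g) \<and>
          absolutely_continuous (translate_measure act M g) M)"

definition radon_nikodym_cocycle ::
    "('g::{topological_group_add, t2_space, second_countable_topology} \<Rightarrow> 'x \<Rightarrow> 'x) \<Rightarrow>
     'x measure \<Rightarrow> ('g \<Rightarrow> 'x \<Rightarrow> real) \<Rightarrow> bool"
  where "radon_nikodym_cocycle act M \<rho> \<longleftrightarrow>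
     (\<lambda>(g, x). \<rho> g x) \<in> borel_measurable (borel \<Otimes>\<^sub>M M) \<and>
     (\<forall>g. \<forall>x\<in>space M. \<rho> g x > 0) \<and>
     (\<forall>x\<in>space M. \<rho> 0 x = 1) \<and>
     (\<forall>g h. \<forall>x\<in>space M. \<rho> (g + h) x = \<rho> g (act h x) * \<rho> h x) \<and>
     (\<forall>g. AE x in M. ennreal (\<rho> g x) = RN_deriv M (translate_measure act M g) x)"

definition L1_plus :: "'x measure \<Rightarrow> ('x \<Rightarrow> real) set"
  where "L1_plus M = {f. integrable M f \<and> (\<forall>x\<in>space M. f x > 0)}"

definition orbit_integral ::
    "'g measure \<Rightarrow> ('g \<Rightarrow> 'x \<Rightarrow> 'x) \<Rightarrow> ('g \<Rightarrow> 'x \<Rightarrow> real) \<Rightarrow> ('x \<Rightarrow> real) \<Rightarrow> 'x \<Rightarrow> ennreal"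
  where "orbit_integral \<eta> act \<rho> f x = (\<integral>\<^sup>+ g. ennreal (\<rho> g x * f (act g x)) \<partial>\<eta>)"

definition G_invariant :: "('g \<Rightarrow> 'x \<Rightarrow> 'x) \<Rightarrow> 'x set \<Rightarrow> bool"
  where "G_invariant act A \<longleftrightarrow> (\<forall>g. act g ` A = A)"

definition hopf_decomposition ::
    "'g measure \<Rightarrow> ('g \<Rightarrow> 'x \<Rightarrow> 'x) \<Rightarrow> 'x measure \<Rightarrow> ('g \<Rightarrow> 'x \<Rightarrow> real) \<Rightarrow>
     'x set \<Rightarrow> 'x set \<Rightarrow> bool"
  where "hopf_decomposition \<eta> act M \<rho> C D \<longleftrightarrow>
     C \<in> sets M \<and> D \<in> sets M \<and> C \<union> D = space M \<and> C \<inter> D = {} \<and>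
     G_invariant act C \<and> G_invariant act D \<and>
     (\<forall>f\<in>L1_plus M.
        (AE x in M. x \<in> C \<longleftrightarrow> orbit_integral \<eta> act \<rho> f x = \<infinity>) \<and>
        (AE x in M. x \<in> D \<longleftrightarrow> orbit_integral \<eta> act \<rho> f x < \<infinity>))"

text \<open>
  The Hopf decomposition is unique up to null sets, so it does not matter which one is
  used to test \<open>\<mu> D = 0\<close>.
\<close>

definition conservative ::
    "'g measure \<Rightarrow> ('g \<Rightarrow> 'x \<Rightarrow> 'x) \<Rightarrow> 'x measure \<Rightarrow> ('g \<Rightarrow> 'x \<Rightarrow> real) \<Rightarrow> bool"
  where "conservative \<eta> act M \<rho> \<longleftrightarrow>
     (\<exists>C D. hopf_decomposition \<eta> act M \<rho> C D \<and> emeasure M D = 0)"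

definition poincare_recurrent ::
    "('g::topological_space \<Rightarrow> 'x \<Rightarrow> 'x) \<Rightarrow> 'x measure \<Rightarrow> 'x set \<Rightarrow> bool"
  where "poincare_recurrent act M A \<longleftrightarrow>
     (\<forall>K. compact K \<longrightarrow> (\<exists>g. g \<notin> K \<and> emeasure M (A \<inter> act g ` A) > 0))"

definition poincare_haar_recurrent ::
    "'g measure \<Rightarrow> ('g \<Rightarrow> 'x \<Rightarrow> 'x) \<Rightarrow> 'x measure \<Rightarrow> 'x set \<Rightarrow> bool"
  where "poincare_haar_recurrent \<eta> act M A \<longleftrightarrow>
     emeasure \<eta> {g. emeasure M (A \<inter> act g ` A) > 0} = \<infinity>"

text \<open>
  \<^const>\<open>measure_of\<close> yields the zero measure when its argument is not countably additive, and
  \<^const>\<open>emeasure\<close> vanishes on non-measurable sets.  The following facts show that neither default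
  value occurs in the definitions above.
\<close>

lemma borel_G_space_act_measurable:
  assumes "borel_G_space act M"
  shows "act g \<in> M \<rightarrow>\<^sub>M M"
proof -
  have "(\<lambda>(g, x). act g x) \<in> borel \<Otimes>\<^sub>M M \<rightarrow>\<^sub>M M"
    using assms by (simp add: borel_G_space_def)
  then have "(\<lambda>x. (\<lambda>(g, x). act g x) (g, x)) \<in> M \<rightarrow>\<^sub>M M"
    by (rule measurable_compose_Pair1[rotated]) simp
  then show ?thesis by simp
qed

lemma borel_G_space_image_eq:
  assumes "borel_G_space act M" and "A \<subseteq> space M"
  shows "act g ` A = act (- g) -` A \<inter> space M"
proof -
  have sp: "act h x \<in> space M" if "x \<in> space M" for h x
    using measurable_space[OF borel_G_space_act_measurable[OF assms(1)] that] .
  have inv: "act (- h) (act h x) = x" if "x \<in> space M" for h x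
    using assms(1) that unfolding borel_G_space_def by (metis left_minus)
  have inv': "act h (act (- h) x) = x" if "x \<in> space M" for h x
    using inv[OF that, of "- h"] by simp
  show ?thesis
  proof (intro set_eqI iffI)
    fix y assume "y \<in> act g ` A"
    then show "y \<in> act (- g) -` A \<inter> space M" using assms(2) sp inv by auto
  next
    fix y assume "y \<in> act (- g) -` A \<inter> space M"
    then show "y \<in> act g ` A" using inv' by (metis IntD1 IntD2 image_eqI vimageD)
  qed
qed

lemma borel_G_space_image_sets:
  assumes "borel_G_space act M" and "A \<in> sets M"
  shows "act g ` A \<in> sets M"
  using borel_G_space_image_eq[OF assms(1) sets.sets_into_space[OF assms(2)]]
    measurable_sets[OF borel_G_space_act_measurable[OF assms(1)] assms(2)] by simp

lemma translate_measure_eq_distr: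
  assumes "borel_G_space act M"
  shows "translate_measure act M g = distr M M (act (- g))"
  unfolding translate_measure_def distr_def
  by (rule measure_of_eq[OF sets.space_closed])
    (metis assms borel_G_space_image_eq sets.sets_into_space sets.sigma_sets_eq)

lemma emeasure_translate_measure:
  assumes "borel_G_space act M" and "A \<in> sets M"
  shows "emeasure (translate_measure act M g) A = emeasure M (act g ` A)"
  using assms borel_G_space_image_eq[OF assms(1) sets.sets_into_space[OF assms(2)]]
  by (simp add: translate_measure_eq_distr emeasure_distr borel_G_space_act_measurable)

lemma recurrence_set_measurable:
  fixes act :: "'g::{topological_group_add, t2_space, second_countable_topology} \<Rightarrow> 'x \<Rightarrow> 'x"
  assumes "borel_G_space act M" and "sigma_finite_measure M" and A: "A \<in> sets M"
  shows "{g. emeasure M (A \<inter> act g ` A) > 0} \<in> sets borel"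
proof -
  interpret sigma_finite_measure M by fact
  define Q where "Q = {p \<in> space (borel \<Otimes>\<^sub>M M). snd p \<in> A \<and> act (- fst p) (snd p) \<in> A}"
  have m: "(\<lambda>(g, x). act g x) \<in> borel \<Otimes>\<^sub>M M \<rightarrow>\<^sub>M M"
    using assms(1) by (simp add: borel_G_space_def)
  have u: "(\<lambda>g::'g. - g) \<in> borel \<rightarrow>\<^sub>M borel"
    by (intro borel_measurable_continuous_onI continuous_intros)
  have "(\<lambda>p::'g \<times> 'x. (- fst p, snd p)) \<in> borel \<Otimes>\<^sub>M M \<rightarrow>\<^sub>M borel \<Otimes>\<^sub>M M"
    by (rule measurable_Pair[OF measurable_compose[OF measurable_fst u] measurable_snd])
  from measurable_compose[OF this m]
  have m2: "(\<lambda>p. act (- fst p) (snd p)) \<in> borel \<Otimes>\<^sub>M M \<rightarrow>\<^sub>M M" by simp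
  have "Q = (snd -` A \<inter> space (borel \<Otimes>\<^sub>M M)) \<inter>
      ((\<lambda>p. act (- fst p) (snd p)) -` A \<inter> space (borel \<Otimes>\<^sub>M M))"
    unfolding Q_def by auto
  then have Q: "Q \<in> sets (borel \<Otimes>\<^sub>M M)"
    by (simp only:) (rule sets.Int[OF measurable_sets[OF measurable_snd A] measurable_sets[OF m2 A]])
  have "Pair g -` Q = A \<inter> act g ` A" for g
    using borel_G_space_image_eq[OF assms(1) sets.sets_into_space[OF A], of g]
      sets.sets_into_space[OF A]
    unfolding Q_def by (auto simp: space_pair_measure)
  then have "(\<lambda>g. emeasure M (A \<inter> act g ` A)) \<in> borel_measurable borel"
    using measurable_emeasure_Pair[OF Q] by simp
  then show ?thesis
    by (simp add: borel_measurable_iff_greater)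
qed

end

theory Submission
  imports Defs
begin

text \<open>
  The link between the three conditions is the notion of a transient set \<open>A\<close>: there is a compact
  \<open>L\<close> such that a point of \<open>A\<close> can be moved back into \<open>A\<close> only by elements of \<open>L\<close>.  Each condition
  turns out to say that transient sets are null.

  To a function \<open>u \<ge> 0\<close> and a point \<open>x\<close> belongs the orbit measure
  \<open>m\<^sub>x(dg) = \<rho>\<^sub>g(x) u(g.x) d\<eta>(g)\<close> on \<open>G\<close>, whose total mass is the orbit integral of \<open>u\<close>.  The cocycle
  identity and the fact that right translation multiplies \<open>\<eta>\<close> by a constant make it equivariant up to
  a scalar: \<open>m\<^bsub>h.x\<^esub>(E)\<close> is proportional to \<open>m\<^sub>x(Eh)\<close> (\<open>orbit_measure_translate\<close>).  So where the orbit
  integral is positive and finite, normalisation gives an equivariant map from points to probability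
  measures on \<open>G\<close>.  Let \<open>A\<close> be the set of points whose probability measure gives a compact set \<open>K\<close>
  more than half of its mass.  If \<open>x\<close> and \<open>h.x\<close> both lie in \<open>A\<close>, then \<open>K\<close> and \<open>Kh\<close> both carry more
  than half of \<open>m\<^sub>x\<close>, so they meet and \<open>h\<close> lies in the compact set \<open>K\<^sup>-\<^sup>1K\<close>.  Exhausting \<open>G\<close> by compact
  sets, one obtains a transient set of positive measure as soon as the orbit integral of some \<open>u\<close> is
  positive and finite on a set of positive measure (\<open>transient_if_orbit_mass_finite\<close>).

  A transient set is plainly not Poincare recurrent, so if all positive sets are recurrent, then no
  integrable positive function has a finite orbit integral on a set of positive measure, and the
  action is conservative.

  For the other direction, exchanging integrals gives
  \<open>\<integral> v S\<^sub>u d\<mu> = \<integral>\<integral> v(g\<^sup>-\<^sup>1.y) u(y) d\<mu>(y) d\<eta>(g)\<close> (\<open>nn_integral_orbit_mass\<close>), and this is used twice.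
  If the return set \<open>R\<close> of a positive set \<open>A\<close> has finite Haar measure, take \<open>v = 1\<^sub>A\<close> and \<open>u = 1\<^sub>A h\<close>
  with \<open>h > 0\<close> of finite integral: the right side is at most \<open>\<eta>(R) \<integral> h d\<mu>\<close>, so the orbit integral
  of \<open>u\<close> is finite almost everywhere on \<open>A\<close>; it is also positive there
  (\<open>orbit_mass_positive\<close>), and a positive transient set exists (\<open>transient_if_not_haar_recurrent\<close>).
  If \<open>A\<close> is transient, take \<open>v = 1\<^sub>A\<close> and any integrable \<open>u\<close>: the set of \<open>g\<close> with \<open>g\<^sup>-\<^sup>1.y \<in> A\<close> lies in
  a translate of one fixed compact set, so the orbit integral of \<open>u\<close> is finite a.e. on \<open>A\<close>
  (\<open>orbit_mass_finite_on_transient\<close>), which conservativity excludes unless \<open>A\<close> is null.  Hence in a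
  conservative action every positive set is Haar-recurrent; and Haar-recurrence implies recurrence
  because compact sets have finite Haar measure.
\<close>

section \<open>Haar measure\<close>

lemma group_uminus_measurable [measurable]:
  fixes f :: "'a \<Rightarrow> 'g::{topological_group_add, t2_space, second_countable_topology}"
  assumes "f \<in> M \<rightarrow>\<^sub>M borel"
  shows "(\<lambda>x. - f x) \<in> M \<rightarrow>\<^sub>M borel"
  by (rule measurable_compose[OF assms borel_measurable_continuous_onI])
    (intro continuous_intros)

lemma group_plus_measurable [measurable]:
  fixes f g :: "'a \<Rightarrow> 'g::{topological_group_add, t2_space, second_countable_topology}"
  assumes "f \<in> M \<rightarrow>\<^sub>M borel" "g \<in> M \<rightarrow>\<^sub>M borel"
  shows "(\<lambda>x. f x + g x) \<in> M \<rightarrow>\<^sub>M borel"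
  by (rule borel_measurable_continuous_Pair[OF assms]) (intro continuous_intros)

lemma compact_exhaustion:
  assumes "locally_compact_space (euclidean :: 'g::{t2_space, second_countable_topology} topology)"
  obtains K :: "nat \<Rightarrow> 'g::{t2_space, second_countable_topology} set"
  where "\<And>n. compact (K n)" "incseq K" "(\<Union>n. K n) = UNIV"
proof -
  define F where "F = {U :: 'g set. open U \<and> (\<exists>K. compact K \<and> U \<subseteq> K)}"
  have F_UNIV: "\<Union>F = UNIV"
    using assms unfolding locally_compact_space_def F_def by auto meson
  obtain F' where F': "F' \<subseteq> F" "countable F'" "\<Union>F' = \<Union>F"
    using Lindelof[of F] unfolding F_def by blast
  have "F' \<noteq> {}" using F'(3) F_UNIV by auto
  define U where "U = from_nat_into F'"
  have rU: "range U = F'"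
    unfolding U_def by (rule range_from_nat_into[OF \<open>F' \<noteq> {}\<close> F'(2)])
  have "\<forall>n. \<exists>K. compact K \<and> U n \<subseteq> K"
    using rU F'(1) unfolding F_def by blast
  then obtain k where k: "\<And>n. compact (k n)" "\<And>n. U n \<subseteq> k n" by metis
  show thesis
  proof
    show "compact (\<Union>i\<le>n. k i)" for n by (intro compact_UN) (auto simp: k)
    show "incseq (\<lambda>n. \<Union>i\<le>n. k i)" by (fastforce simp: incseq_def)
    have "x \<in> (\<Union>n. \<Union>i\<le>n. k i)" for x
    proof -
      have "x \<in> \<Union>(range U)" using rU F'(3) F_UNIV by simp
      then show ?thesis using k(2) by blast
    qed
    then show "(\<Union>n. \<Union>i\<le>n. k i) = UNIV" by blast
  qed
qed

locale haar =
  fixes \<eta> :: "'g::{topological_group_add, t2_space, second_countable_topology} measure"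
  assumes left_haar: "left_haar_measure \<eta>"
    and locally_compact: "locally_compact_space (euclidean :: 'g topology)"
begin

lemma sets_haar [measurable_cong, simp]: "sets \<eta> = sets borel"
  using left_haar by (simp add: left_haar_measure_def)

lemma space_haar [simp]: "space \<eta> = UNIV"
  using sets_eq_imp_space_eq[OF sets_haar] by simp

lemma compact_finite: "compact K \<Longrightarrow> emeasure \<eta> K < \<infinity>"
  using left_haar by (simp add: left_haar_measure_def)

lemma UNIV_nonzero: "emeasure \<eta> UNIV \<noteq> 0"
  using left_haar by (simp add: left_haar_measure_def)

sublocale sigma_finite_measure \<eta>
proof -
  obtain K :: "nat \<Rightarrow> 'g set" where K: "\<And>n. compact (K n)" "incseq K" "(\<Union>n. K n) = UNIV"
    using compact_exhaustion[OF locally_compact] by metis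
  show "sigma_finite_measure \<eta>"
  proof (unfold_locales, intro exI conjI)
    show "range K \<subseteq> sets \<eta>" using K(1) by (auto intro: borel_compact)
    show "\<forall>a\<in>range K. emeasure \<eta> a \<noteq> \<infinity>"
      using compact_finite[OF K(1)] by (auto simp: less_top)
  qed (use K(3) in auto)
qed

lemma emeasure_vimage_translate:
  assumes "A \<in> sets borel"
  shows "emeasure \<eta> ((\<lambda>h. g + h) -` A) = emeasure \<eta> A"
proof -
  have "(\<lambda>h. g + h) -` A = (\<lambda>h. - g + h) ` A"
    by (auto simp: image_iff algebra_simps) (metis add.assoc add.left_neutral left_minus)
  then show ?thesis
    using left_haar assms by (simp only: left_haar_measure_def)
qed

lemma nn_integral_left_translate:
  assumes [measurable]: "\<phi> \<in> borel_measurable borel"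
  shows "(\<integral>\<^sup>+ x. \<phi> (g + x) \<partial>\<eta>) = (\<integral>\<^sup>+ x. \<phi> x \<partial>\<eta>)"
proof -
  have "distr \<eta> \<eta> (\<lambda>h. g + h) = \<eta>"
    by (rule measure_eqI) (simp_all add: emeasure_distr emeasure_vimage_translate)
  then have "(\<integral>\<^sup>+ x. \<phi> x \<partial>\<eta>) = (\<integral>\<^sup>+ x. \<phi> x \<partial>distr \<eta> \<eta> (\<lambda>h. g + h))"
    by simp
  also have "\<dots> = (\<integral>\<^sup>+ x. \<phi> (g + x) \<partial>\<eta>)"
    by (rule nn_integral_distr) simp_all
  finally show ?thesis by simp
qed

text \<open>
  Countably many translates of a nonempty open set cover the group, so a null open set would make
  the whole group null.
\<close>

lemma open_positive:
  assumes "open U" "U \<noteq> {}"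
  shows "emeasure \<eta> U > 0"
proof (rule ccontr)
  assume "\<not> emeasure \<eta> U > 0"
  then have 0: "emeasure \<eta> U = 0" by simp
  obtain u where u: "u \<in> U" using assms(2) by blast
  define F where "F = range (\<lambda>g. (\<lambda>h. g + h) -` U)"
  have "open S" if "S \<in> F" for S
    using that assms(1) unfolding F_def
    by (auto intro!: open_vimage continuous_intros)
  then obtain F' where F': "F' \<subseteq> F" "countable F'" "\<Union>F' = \<Union>F"
    by (rule Lindelof)
  have "\<Union>F = UNIV"
  proof -
    have "x \<in> (\<lambda>h. (u - x) + h) -` U" for x
      using u by simp
    then show ?thesis unfolding F_def by blast
  qed
  moreover have "S \<in> null_sets \<eta>" if "S \<in> F'" for S
  proof -
    have "open S" "emeasure \<eta> S = 0"
      using that F'(1) 0 emeasure_vimage_translate[of U] assms(1) \<open>\<And>S. S \<in> F \<Longrightarrow> open S\<close>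
      unfolding F_def by auto
    then show ?thesis by (simp add: null_sets_def)
  qed
  then have "(\<Union>S\<in>F'. S) \<in> null_sets \<eta>"
    by (rule null_sets_UN'[OF F'(2)])
  ultimately show False using F'(3) UNIV_nonzero by (auto simp: null_sets_def)
qed

end

lemma vimage_translate_right:
  fixes h :: "'g::group_add"
  shows "(\<lambda>x. x + h) -` A = (\<lambda>x. x - h) ` A"
  by (auto simp: image_iff) (metis add_diff_cancel)

text \<open>
  Weil's argument for the uniqueness of Haar measure.  For left-invariant \<open>\<mu>\<close> and \<open>\<nu>\<close>, the
  substitutions \<open>y \<mapsto> -x + y\<close> and then \<open>x \<mapsto> y + x\<close> turn \<open>\<integral>\<integral> F(x, y) d\<nu>(y) d\<mu>(x)\<close> into
  \<open>\<integral>\<integral> F(y + x, -x) d\<nu>(y) d\<mu>(x)\<close>.  A product \<open>F\<close> with first factor \<open>1\<^sub>K\<close> separates the variables on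
  the left, and its second factor is chosen such that the inner integral on the right is \<open>\<phi>(x)\<close>.
  The point of the formula is that \<open>\<mu>\<close> enters its right-hand side only through \<open>\<mu> K\<close>.
\<close>

lemma nn_integral_via_auxiliary_haar:
  fixes \<mu> \<nu> :: "'g::{topological_group_add, t2_space, second_countable_topology} measure"
  assumes "haar \<mu>" "haar \<nu>" and K: "compact K" "interior K \<noteq> {}"
    and [measurable]: "\<phi> \<in> borel_measurable borel"
  shows "(\<integral>\<^sup>+ x. \<phi> x \<partial>\<mu>) =
    emeasure \<mu> K * (\<integral>\<^sup>+ y. \<phi> (- y) / emeasure \<nu> ((\<lambda>z. z + - y) -` K) \<partial>\<nu>)"
proof -
  interpret \<mu>: haar \<mu> by fact
  interpret \<nu>: haar \<nu> by fact
  interpret pair_sigma_finite \<mu> \<nu> ..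
  have [measurable]: "K \<in> sets borel" using K(1) by (rule borel_compact)
  define w where "w x = emeasure \<nu> ((\<lambda>z. z + x) -` K)" for x
  have w_int: "w x = (\<integral>\<^sup>+ y. indicator K (y + x) \<partial>\<nu>)" for x
  proof -
    have "(\<integral>\<^sup>+ y. indicator K (y + x) \<partial>\<nu>) = (\<integral>\<^sup>+ y. indicator ((\<lambda>z. z + x) -` K) y \<partial>\<nu>)"
      by (simp add: indicator_def)
    also have "\<dots> = w x"
      unfolding w_def using measurable_sets[of "\<lambda>z. z + x" borel borel K] by simp
    finally show ?thesis by simp
  qed
  have [measurable]: "w \<in> borel_measurable borel"
    unfolding w_int by measurable
  have w_fin: "w x < top" for x
  proof -
    have "compact ((\<lambda>z. z + x) -` K)"
      unfolding vimage_translate_right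
      by (intro compact_continuous_image K continuous_intros)
    then show ?thesis unfolding w_def using \<nu>.compact_finite by simp
  qed
  have w_pos: "w x > 0" for x
  proof -
    have "open ((\<lambda>z. z + x) -` interior K)"
      by (intro open_vimage continuous_intros) simp
    moreover have "(\<lambda>z. z + x) -` interior K \<noteq> {}"
      using K(2) unfolding vimage_translate_right by simp
    ultimately have "0 < emeasure \<nu> ((\<lambda>z. z + x) -` interior K)"
      by (rule \<nu>.open_positive)
    also have "\<dots> \<le> w x"
      unfolding w_def using measurable_sets[of "\<lambda>z. z + x" borel borel K] interior_subset[of K]
      by (intro emeasure_mono) auto
    finally show ?thesis .
  qed
  \<comment> \<open>The division by \<open>w\<close> cancels the factor that integration of \<open>1\<^sub>K(y + x)\<close> over \<open>y\<close> produces.\<close>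
  define \<psi> where "\<psi> y = \<phi> (- y) / w (- y)" for y
  have [measurable]: "\<psi> \<in> borel_measurable borel"
    unfolding \<psi>_def by measurable
  have "emeasure \<mu> K * (\<integral>\<^sup>+ y. \<psi> y \<partial>\<nu>) = (\<integral>\<^sup>+ x. indicator K x * (\<integral>\<^sup>+ y. \<psi> y \<partial>\<nu>) \<partial>\<mu>)"
    by (simp add: nn_integral_multc)
  also have "\<dots> = (\<integral>\<^sup>+ x. indicator K x * (\<integral>\<^sup>+ y. \<psi> (- x + y) \<partial>\<nu>) \<partial>\<mu>)"
    by (simp add: \<nu>.nn_integral_left_translate)
  also have "\<dots> = (\<integral>\<^sup>+ x. \<integral>\<^sup>+ y. indicator K x * \<psi> (- x + y) \<partial>\<nu> \<partial>\<mu>)"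
    by (simp add: nn_integral_cmult)
  also have "\<dots> = (\<integral>\<^sup>+ y. \<integral>\<^sup>+ x. indicator K x * \<psi> (- x + y) \<partial>\<mu> \<partial>\<nu>)"
    by (rule Fubini'[symmetric]) measurable
  also have "\<dots> = (\<integral>\<^sup>+ y. \<integral>\<^sup>+ x. indicator K (y + x) * \<psi> (- (y + x) + y) \<partial>\<mu> \<partial>\<nu>)"
    by (subst \<mu>.nn_integral_left_translate) simp_all
  also have "\<dots> = (\<integral>\<^sup>+ y. \<integral>\<^sup>+ x. indicator K (y + x) * \<psi> (- x) \<partial>\<mu> \<partial>\<nu>)"
    by (simp add: minus_add add.assoc)
  also have "\<dots> = (\<integral>\<^sup>+ x. \<integral>\<^sup>+ y. indicator K (y + x) * \<psi> (- x) \<partial>\<nu> \<partial>\<mu>)"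
    by (rule Fubini') measurable
  also have "\<dots> = (\<integral>\<^sup>+ x. w x * \<psi> (- x) \<partial>\<mu>)"
    by (simp add: nn_integral_multc w_int)
  also have "\<dots> = (\<integral>\<^sup>+ x. \<phi> x \<partial>\<mu>)"
    using w_fin w_pos unfolding \<psi>_def
    by (intro nn_integral_cong)
      (simp add: mult.commute[of "w _"] ennreal_divide_times mult_divide_eq_ennreal
        less_imp_neq[symmetric] less_top)
  finally show ?thesis by (simp add: \<psi>_def w_def)
qed

text \<open>
  Applying the previous formula to both measures with the same auxiliary measure \<open>\<mu>\<close> gives the
  same factor of proportionality for every \<open>\<phi>\<close>.
\<close>

lemma haar_unique:
  fixes \<mu> \<nu> :: "'g::{topological_group_add, t2_space, second_countable_topology} measure"
  assumes "haar \<mu>" "haar \<nu>"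
  obtains c :: ennreal where "c \<noteq> 0" "c \<noteq> top"
    "\<And>\<phi>. \<phi> \<in> borel_measurable borel \<Longrightarrow> (\<integral>\<^sup>+ x. \<phi> x \<partial>\<nu>) = c * (\<integral>\<^sup>+ x. \<phi> x \<partial>\<mu>)"
proof -
  interpret \<mu>: haar \<mu> by fact
  interpret \<nu>: haar \<nu> by fact
  obtain U K :: "'g set" where UK: "open U" "compact K" "0 \<in> U" "U \<subseteq> K"
    using \<mu>.locally_compact unfolding locally_compact_space_def by auto meson
  then have int: "interior K \<noteq> {}"
    using interior_maximal by blast
  have pos: "0 < emeasure \<mu> K" "0 < emeasure \<nu> K"
  proof -
    have "0 < emeasure \<mu> U" "0 < emeasure \<nu> U"
      using \<mu>.open_positive \<nu>.open_positive UK by blast+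
    then show "0 < emeasure \<mu> K" "0 < emeasure \<nu> K"
      using emeasure_mono[OF UK(4), of \<mu>] emeasure_mono[OF UK(4), of \<nu>] UK(2)
      by (auto simp: borel_compact intro: less_le_trans)
  qed
  have fin: "emeasure \<mu> K < top" "emeasure \<nu> K < top"
    using \<mu>.compact_finite \<nu>.compact_finite UK(2) by auto
  show thesis
  proof
    show "emeasure \<nu> K / emeasure \<mu> K \<noteq> 0" "emeasure \<nu> K / emeasure \<mu> K \<noteq> top"
      using pos fin by (auto simp: ennreal_divide_eq_0_iff ennreal_divide_eq_top_iff)
    fix \<phi> :: "'g \<Rightarrow> ennreal"
    assume \<phi>: "\<phi> \<in> borel_measurable borel"
    define I where "I = (\<integral>\<^sup>+ y. \<phi> (- y) / emeasure \<mu> ((\<lambda>z. z + - y) -` K) \<partial>\<mu>)"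
    have "(\<integral>\<^sup>+ x. \<phi> x \<partial>\<nu>) = emeasure \<nu> K * I" "(\<integral>\<^sup>+ x. \<phi> x \<partial>\<mu>) = emeasure \<mu> K * I"
      unfolding I_def using nn_integral_via_auxiliary_haar[OF _ assms(1) UK(2) int \<phi>] assms by auto
    then show "(\<integral>\<^sup>+ x. \<phi> x \<partial>\<nu>) = emeasure \<nu> K / emeasure \<mu> K * (\<integral>\<^sup>+ x. \<phi> x \<partial>\<mu>)"
      using pos fin
      by (simp add: mult.assoc[symmetric] ennreal_divide_times mult_divide_eq_ennreal less_top
          less_imp_neq[symmetric])
  qed
qed

context haar
begin

text \<open>
  The right translate of a left Haar measure is again left-invariant, so by uniqueness it is a
  multiple of the original one.  The constant is a value of the modular function.
\<close>

lemma nn_integral_right_translate: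
  obtains c :: ennreal where "c \<noteq> 0" "c \<noteq> top"
    "\<And>\<phi>. \<phi> \<in> borel_measurable borel \<Longrightarrow> (\<integral>\<^sup>+ x. \<phi> (x + h) \<partial>\<eta>) = c * (\<integral>\<^sup>+ x. \<phi> x \<partial>\<eta>)"
proof -
  define \<nu> where "\<nu> = distr \<eta> borel (\<lambda>x. x + h)"
  have em: "emeasure \<nu> A = emeasure \<eta> ((\<lambda>x. x + h) -` A)" if "A \<in> sets borel" for A
    unfolding \<nu>_def using that by (simp add: emeasure_distr)
  have "left_haar_measure \<nu>"
    unfolding left_haar_measure_def
  proof (intro conjI allI impI ballI)
    show "sets \<nu> = sets borel" by (simp add: \<nu>_def)
    show "emeasure \<nu> UNIV \<noteq> 0" using UNIV_nonzero by (simp add: em)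
    show "emeasure \<nu> K < \<infinity>" if "compact K" for K
      using that unfolding em[OF borel_compact[OF that]] vimage_translate_right
      by (intro compact_finite compact_continuous_image continuous_intros)
    fix g and A :: "'g set" assume A: "A \<in> sets borel"
    have im: "(\<lambda>x. g + x) ` A = (\<lambda>x. - g + x) -` A"
      by (auto simp: image_iff add.assoc[symmetric]) (metis add_minus_cancel)
    have 1: "(\<lambda>x. - g + x) -` A \<in> sets borel"
      using measurable_sets[of "\<lambda>x. - g + x" borel borel A] A by simp
    have 2: "(\<lambda>x. x + h) -` A \<in> sets borel"
      using measurable_sets[of "\<lambda>x. x + h" borel borel A] A by simp
    have "(\<lambda>x. x + h) -` (\<lambda>x. - g + x) -` A = (\<lambda>x. - g + x) -` (\<lambda>x. x + h) -` A"
      by (auto simp: add.assoc)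
    then show "emeasure \<nu> ((\<lambda>x. g + x) ` A) = emeasure \<nu> A"
      unfolding im using A 1 2 by (simp add: em emeasure_vimage_translate)
  qed
  then have "haar \<nu>" using locally_compact by unfold_locales
  then obtain c :: ennreal where c: "c \<noteq> 0" "c \<noteq> top"
    "\<And>\<phi>. \<phi> \<in> borel_measurable borel \<Longrightarrow> (\<integral>\<^sup>+ x. \<phi> x \<partial>\<nu>) = c * (\<integral>\<^sup>+ x. \<phi> x \<partial>\<eta>)"
    using haar_unique[OF haar_axioms] by metis
  show thesis
  proof (rule that[OF c(1,2)])
    fix \<phi> :: "'g \<Rightarrow> ennreal" assume [measurable]: "\<phi> \<in> borel_measurable borel"
    have "(\<integral>\<^sup>+ x. \<phi> (x + h) \<partial>\<eta>) = (\<integral>\<^sup>+ x. \<phi> x \<partial>\<nu>)"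
      unfolding \<nu>_def by (subst nn_integral_distr) simp_all
    then show "(\<integral>\<^sup>+ x. \<phi> (x + h) \<partial>\<eta>) = c * (\<integral>\<^sup>+ x. \<phi> x \<partial>\<eta>)"
      using c(3) by simp
  qed
qed

end

section \<open>Nonsingular actions and orbit measures\<close>

locale nonsingular_action = haar \<eta>
  for \<eta> :: "'g::{topological_group_add, t2_space, second_countable_topology} measure" +
  fixes act :: "'g \<Rightarrow> 'x \<Rightarrow> 'x" and \<mu> :: "'x measure" and \<rho> :: "'g \<Rightarrow> 'x \<Rightarrow> real"
  assumes nonsingular: "nonsingular_G_space act \<mu>"
    and cocycle: "radon_nikodym_cocycle act \<mu> \<rho>"
begin

lemma G_space: "borel_G_space act \<mu>"
  using nonsingular by (simp add: nonsingular_G_space_def)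

sublocale base: sigma_finite_measure \<mu>
  using nonsingular by (simp add: nonsingular_G_space_def)

sublocale pair: pair_sigma_finite \<eta> \<mu> ..

lemma act_measurable [measurable]:
  assumes "f \<in> N \<rightarrow>\<^sub>M borel" "h \<in> N \<rightarrow>\<^sub>M \<mu>"
  shows "(\<lambda>x. act (f x) (h x)) \<in> N \<rightarrow>\<^sub>M \<mu>"
proof -
  have "(\<lambda>(g, x). act g x) \<in> borel \<Otimes>\<^sub>M \<mu> \<rightarrow>\<^sub>M \<mu>"
    using G_space by (simp add: borel_G_space_def)
  from measurable_compose[OF measurable_Pair[OF assms] this] show ?thesis by simp
qed

lemma cocycle_measurable [measurable]:
  assumes "f \<in> N \<rightarrow>\<^sub>M borel" "h \<in> N \<rightarrow>\<^sub>M \<mu>"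
  shows "(\<lambda>x. \<rho> (f x) (h x)) \<in> borel_measurable N"
proof -
  have "(\<lambda>(g, x). \<rho> g x) \<in> borel_measurable (borel \<Otimes>\<^sub>M \<mu>)"
    using cocycle by (simp add: radon_nikodym_cocycle_def)
  from measurable_compose[OF measurable_Pair[OF assms] this] show ?thesis by simp
qed

lemma act_space [simp]: "x \<in> space \<mu> \<Longrightarrow> act g x \<in> space \<mu>"
  using measurable_space[OF borel_G_space_act_measurable[OF G_space]] .

lemma act_zero: "x \<in> space \<mu> \<Longrightarrow> act 0 x = x"
  using G_space by (simp add: borel_G_space_def)

lemma act_add: "x \<in> space \<mu> \<Longrightarrow> act (g + h) x = act g (act h x)"
  using G_space by (simp add: borel_G_space_def)

lemma act_inverse: "x \<in> space \<mu> \<Longrightarrow> act (- g) (act g x) = x"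
  using act_add[of x "- g" g] by (simp add: act_zero)

lemma act_inverse': "x \<in> space \<mu> \<Longrightarrow> act g (act (- g) x) = x"
  using act_add[of x g "- g"] by (simp add: act_zero)

lemma cocycle_pos: "x \<in> space \<mu> \<Longrightarrow> \<rho> g x > 0"
  using cocycle by (simp add: radon_nikodym_cocycle_def)

lemma cocycle_add: "x \<in> space \<mu> \<Longrightarrow> \<rho> (g + h) x = \<rho> g (act h x) * \<rho> h x"
  using cocycle by (simp add: radon_nikodym_cocycle_def)

text \<open>
  The density \<open>\<rho>\<^sub>g\<close> compensates the distortion of \<open>\<mu>\<close> by \<open>g\<close>, being the derivative of \<open>\<mu> \<circ> g\<close>.
\<close>

lemma nn_integral_cocycle:
  assumes [measurable]: "u \<in> borel_measurable \<mu>"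
  shows "(\<integral>\<^sup>+ x. ennreal (\<rho> g x) * u (act g x) \<partial>\<mu>) = (\<integral>\<^sup>+ x. u x \<partial>\<mu>)"
proof -
  let ?T = "translate_measure act \<mu> g"
  have T: "?T = distr \<mu> \<mu> (act (- g))"
    by (rule translate_measure_eq_distr[OF G_space])
  have "density \<mu> (\<lambda>x. ennreal (\<rho> g x)) = density \<mu> (RN_deriv \<mu> ?T)"
    using cocycle by (intro density_cong) (auto simp: radon_nikodym_cocycle_def)
  also have "\<dots> = ?T"
    using nonsingular by (intro base.density_RN_deriv) (simp_all add: nonsingular_G_space_def, simp add: T)
  finally have dens: "density \<mu> (\<lambda>x. ennreal (\<rho> g x)) = distr \<mu> \<mu> (act (- g))"
    by (simp add: T)
  have "(\<integral>\<^sup>+ x. ennreal (\<rho> g x) * u (act g x) \<partial>\<mu>) =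
      (\<integral>\<^sup>+ x. u (act g x) \<partial>density \<mu> (\<lambda>x. ennreal (\<rho> g x)))"
    by (subst nn_integral_density) simp_all
  also have "\<dots> = (\<integral>\<^sup>+ x. u (act g (act (- g) x)) \<partial>\<mu>)"
    unfolding dens by (subst nn_integral_distr) simp_all
  also have "\<dots> = (\<integral>\<^sup>+ x. u x \<partial>\<mu>)"
    by (intro nn_integral_cong) (simp add: act_inverse')
  finally show ?thesis .
qed

text \<open>
  Functions with values in \<^typ>\<open>ennreal\<close> are admitted, and they may vanish, because indicators of
  sets will be used as well as the functions in \<^const>\<open>L1_plus\<close>.
\<close>

definition orbit_measure :: "('x \<Rightarrow> ennreal) \<Rightarrow> 'x \<Rightarrow> 'g measure"
  where "orbit_measure u x = density \<eta> (\<lambda>g. ennreal (\<rho> g x) * u (act g x))"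

abbreviation orbit_mass :: "('x \<Rightarrow> ennreal) \<Rightarrow> 'x \<Rightarrow> ennreal"
  where "orbit_mass u x \<equiv> emeasure (orbit_measure u x) UNIV"

lemma sets_orbit_measure [simp]: "sets (orbit_measure u x) = sets borel"
  by (simp add: orbit_measure_def)

lemma emeasure_orbit_measure:
  assumes [measurable]: "u \<in> borel_measurable \<mu>" "E \<in> sets borel" and "x \<in> space \<mu>"
  shows "emeasure (orbit_measure u x) E =
    (\<integral>\<^sup>+ g. ennreal (\<rho> g x) * u (act g x) * indicator E g \<partial>\<eta>)"
  unfolding orbit_measure_def using assms(3) by (subst emeasure_density) simp_all

lemma orbit_mass_eq:
  assumes "u \<in> borel_measurable \<mu>" and "x \<in> space \<mu>"
  shows "orbit_mass u x = (\<integral>\<^sup>+ g. ennreal (\<rho> g x) * u (act g x) \<partial>\<eta>)"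
  using emeasure_orbit_measure[OF assms(1) _ assms(2), of UNIV] by simp

lemma orbit_integral_eq_orbit_mass:
  assumes "f \<in> borel_measurable \<mu>" and "x \<in> space \<mu>"
  shows "orbit_integral \<eta> act \<rho> f x = orbit_mass (\<lambda>x. ennreal (f x)) x"
  using assms
  by (simp add: orbit_integral_def orbit_mass_eq ennreal_mult' less_imp_le[OF cocycle_pos])

lemma orbit_measure_measurable [measurable]:
  assumes [measurable]: "u \<in> borel_measurable \<mu>" "E \<in> sets borel"
  shows "(\<lambda>x. emeasure (orbit_measure u x) E) \<in> borel_measurable \<mu>"
proof -
  have "(\<lambda>x. \<integral>\<^sup>+ g. ennreal (\<rho> g x) * u (act g x) * indicator E g \<partial>\<eta>) \<in> borel_measurable \<mu>"
    by measurable
  then show ?thesis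
    by (subst measurable_cong[OF emeasure_orbit_measure[OF assms]]) simp_all
qed

text \<open>
  Equivariance of the orbit measures up to a scalar.  The substitution \<open>g \<mapsto> g + h\<close> costs the modular
  constant, and the cocycle identity costs \<open>\<rho>\<^sub>h(x)\<close>; neither depends on \<open>E\<close>.
\<close>

lemma orbit_measure_translate:
  assumes [measurable]: "u \<in> borel_measurable \<mu>" and x: "x \<in> space \<mu>"
  obtains k :: ennreal where "k \<noteq> 0" "k \<noteq> top"
    "\<And>E. E \<in> sets borel \<Longrightarrow> emeasure (orbit_measure u (act h x)) E =
       k * emeasure (orbit_measure u x) ((\<lambda>g. g - h) -` E)"
proof -
  obtain c :: ennreal where c: "c \<noteq> 0" "c \<noteq> top"
    "\<And>\<phi>. \<phi> \<in> borel_measurable borel \<Longrightarrow> (\<integral>\<^sup>+ g. \<phi> (g + h) \<partial>\<eta>) = c * (\<integral>\<^sup>+ g. \<phi> g \<partial>\<eta>)"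
    using nn_integral_right_translate by metis
  define r where "r = \<rho> h x"
  have r: "r > 0" unfolding r_def using x by (rule cocycle_pos)
  show thesis
  proof
    show "ennreal (1 / r) * c \<noteq> 0" "ennreal (1 / r) * c \<noteq> top"
      using c(1,2) r by (auto simp: ennreal_mult_eq_top_iff)
    fix E :: "'g set" assume E [measurable]: "E \<in> sets borel"
    have sub: "(\<lambda>g. g - h) \<in> borel \<rightarrow>\<^sub>M borel"
      unfolding diff_conv_add_uminus by measurable
    have E' [measurable]: "(\<lambda>g. g - h) -` E \<in> sets borel"
      using measurable_sets[OF sub E] by simp
    let ?m = "emeasure (orbit_measure u (act h x)) E"
    define \<phi> where
      "\<phi> g = ennreal (\<rho> g x) * u (act g x) * indicator ((\<lambda>g. g - h) -` E) g" for g
    have [measurable]: "\<phi> \<in> borel_measurable borel"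
      unfolding \<phi>_def using x by measurable
    have "ennreal r * ?m =
        (\<integral>\<^sup>+ g. ennreal r * (ennreal (\<rho> g (act h x)) * u (act g (act h x)) * indicator E g) \<partial>\<eta>)"
      using x by (simp add: emeasure_orbit_measure nn_integral_cmult)
    also have "\<dots> = (\<integral>\<^sup>+ g. \<phi> (g + h) \<partial>\<eta>)"
      using x r unfolding \<phi>_def
      by (intro nn_integral_cong)
        (simp add: r_def cocycle_add act_add ennreal_mult less_imp_le[OF cocycle_pos]
          indicator_def ac_simps)
    also have "\<dots> = c * (\<integral>\<^sup>+ g. \<phi> g \<partial>\<eta>)" by (rule c(3)) measurable
    also have "(\<integral>\<^sup>+ g. \<phi> g \<partial>\<eta>) = emeasure (orbit_measure u x) ((\<lambda>g. g - h) -` E)"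
      unfolding \<phi>_def using x by (simp add: emeasure_orbit_measure)
    finally have eq: "ennreal r * ?m = c * emeasure (orbit_measure u x) ((\<lambda>g. g - h) -` E)" .
    have "?m = ennreal (1 / r) * (ennreal r * ?m)"
      using r by (simp add: mult.assoc[symmetric] ennreal_mult[symmetric])
    then show "?m = ennreal (1 / r) * c * emeasure (orbit_measure u x) ((\<lambda>g. g - h) -` E)"
      unfolding eq by (simp add: mult.assoc)
  qed
qed

text \<open>
  Duality between the action weighted by the cocycle on \<open>u\<close> and the unweighted inverse action on
  \<open>v\<close>.
\<close>

lemma nn_integral_orbit_mass:
  assumes [measurable]: "u \<in> borel_measurable \<mu>" "v \<in> borel_measurable \<mu>"
  shows "(\<integral>\<^sup>+ x. v x * orbit_mass u x \<partial>\<mu>) =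
    (\<integral>\<^sup>+ g. \<integral>\<^sup>+ y. v (act (- g) y) * u y \<partial>\<mu> \<partial>\<eta>)"
proof -
  have "(\<integral>\<^sup>+ x. v x * orbit_mass u x \<partial>\<mu>) =
      (\<integral>\<^sup>+ x. \<integral>\<^sup>+ g. v x * (ennreal (\<rho> g x) * u (act g x)) \<partial>\<eta> \<partial>\<mu>)"
    by (intro nn_integral_cong) (simp add: orbit_mass_eq nn_integral_cmult)
  also have "\<dots> = (\<integral>\<^sup>+ g. \<integral>\<^sup>+ x. v x * (ennreal (\<rho> g x) * u (act g x)) \<partial>\<mu> \<partial>\<eta>)"
    by (rule pair.Fubini') measurable
  also have "\<dots> = (\<integral>\<^sup>+ g. \<integral>\<^sup>+ y. v (act (- g) y) * u y \<partial>\<mu> \<partial>\<eta>)"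
  proof (rule nn_integral_cong)
    fix g
    have "(\<integral>\<^sup>+ x. v x * (ennreal (\<rho> g x) * u (act g x)) \<partial>\<mu>) =
        (\<integral>\<^sup>+ x. ennreal (\<rho> g x) * (v (act (- g) (act g x)) * u (act g x)) \<partial>\<mu>)"
      by (intro nn_integral_cong) (simp add: act_inverse ac_simps)
    also have "\<dots> = (\<integral>\<^sup>+ y. v (act (- g) y) * u y \<partial>\<mu>)"
      by (rule nn_integral_cocycle) measurable
    finally show "(\<integral>\<^sup>+ x. v x * (ennreal (\<rho> g x) * u (act g x)) \<partial>\<mu>) =
      (\<integral>\<^sup>+ y. v (act (- g) y) * u y \<partial>\<mu>)" .
  qed
  finally show ?thesis .
qed

text \<open>
  Let \<open>Z\<close> be the exceptional set.  As \<open>u > 0\<close> on \<open>Z\<close> and the orbit integral of \<open>u\<close> vanishes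
  there, a point of \<open>Z\<close> is moved into \<open>Z\<close> only by a null set of group elements.  By equivariance the same holds for every orbit that meets \<open>Z\<close> at all, so the
  orbit integral of \<open>1\<^sub>Z\<close> vanishes everywhere; but its integral over the space is
  \<open>\<mu>(Z) \<eta>(G)\<close>.
\<close>

lemma orbit_mass_positive:
  assumes [measurable]: "u \<in> borel_measurable \<mu>"
  shows "AE x in \<mu>. u x > 0 \<longrightarrow> orbit_mass u x > 0"
proof -
  define Z where "Z = {x \<in> space \<mu>. u x > 0 \<and> orbit_mass u x = 0}"
  have [measurable]: "Z \<in> sets \<mu>" unfolding Z_def by measurable
  let ?i = "indicator Z :: 'x \<Rightarrow> ennreal"
  have i: "?i \<in> borel_measurable \<mu>" by measurable
  have on_Z: "orbit_mass ?i z = 0" if z: "z \<in> Z" for z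
  proof -
    have sp: "z \<in> space \<mu>" using z by (simp add: Z_def)
    have "AE g in \<eta>. ennreal (\<rho> g z) * u (act g z) = 0"
      using z sp by (subst nn_integral_0_iff_AE[symmetric]) (simp_all add: Z_def orbit_mass_eq)
    then have "AE g in \<eta>. ennreal (\<rho> g z) * ?i (act g z) = 0"
      by eventually_elim (use cocycle_pos[OF sp] in \<open>auto simp: Z_def indicator_def not_le\<close>)
    then show ?thesis
      using sp by (simp add: orbit_mass_eq nn_integral_0_iff_AE)
  qed
  have "orbit_mass ?i x = 0" if x: "x \<in> space \<mu>" for x
  proof (cases "\<exists>h. act h x \<in> Z")
    case True
    then obtain h where h: "act h x \<in> Z" by blast
    obtain k :: ennreal where k: "k \<noteq> 0"
      "\<And>E. E \<in> sets borel \<Longrightarrow> emeasure (orbit_measure ?i (act h x)) E =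
       k * emeasure (orbit_measure ?i x) ((\<lambda>g. g - h) -` E)"
      using orbit_measure_translate[OF i x, of h] by metis
    show ?thesis using k(1) k(2)[of UNIV] on_Z[OF h] by simp
  qed (use x in \<open>simp add: orbit_mass_eq\<close>)
  then have "0 = (\<integral>\<^sup>+ x. 1 * orbit_mass ?i x \<partial>\<mu>)"
    by (simp cong: nn_integral_cong)
  also have "\<dots> = (\<integral>\<^sup>+ g. \<integral>\<^sup>+ y. 1 * ?i y \<partial>\<mu> \<partial>\<eta>)"
    by (rule nn_integral_orbit_mass) measurable
  also have "\<dots> = emeasure \<mu> Z * emeasure \<eta> UNIV" by simp
  finally have "emeasure \<mu> Z = 0" using UNIV_nonzero by auto
  then have "AE x in \<mu>. x \<notin> Z" by (intro AE_not_in) (simp add: null_sets_def)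
  then show ?thesis by (rule AE_mp) (auto simp: Z_def zero_less_iff_neq_zero intro!: AE_I2)
qed

section \<open>Transient sets\<close>

text \<open>
  Returns to \<open>A\<close> are confined to a compact set pointwise, and not only up to null sets.  Thus the
  time spent in \<open>A\<close> can be bounded uniformly over all orbits.
\<close>

definition transient :: "'x set \<Rightarrow> bool"
  where "transient A \<longleftrightarrow> (\<exists>L. compact L \<and> (\<forall>g. \<forall>x\<in>A. act g x \<in> A \<longrightarrow> g \<in> L))"

lemma transient_not_recurrent:
  assumes "transient A"
  shows "\<not> poincare_recurrent act \<mu> A"
proof -
  obtain L where L: "compact L" "\<And>g x. x \<in> A \<Longrightarrow> act g x \<in> A \<Longrightarrow> g \<in> L"
    using assms unfolding transient_def by blast
  have "A \<inter> act g ` A = {}" if "g \<notin> L" for g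
    using L(2) that by blast
  then show ?thesis
    using L(1) unfolding poincare_recurrent_def by (metis emeasure_empty less_irrefl)
qed

text \<open>
  A point belongs to \<open>A n\<close> if its orbit measure is finite and concentrated for more than half of its
  mass on \<open>K n\<close>.  Two sets that carry more than half of the mass of the same finite measure must
  intersect, which by equivariance confines the elements that bring a point of \<open>A n\<close> back to
  \<open>A n\<close>.
\<close>

lemma transient_if_orbit_mass_finite:
  assumes [measurable]: "u \<in> borel_measurable \<mu>"
    and pos: "\<not> (AE x in \<mu>. \<not> (0 < orbit_mass u x \<and> orbit_mass u x < \<infinity>))"
  obtains A where "A \<in> sets \<mu>" "emeasure \<mu> A > 0" "transient A"
proof -
  obtain K :: "nat \<Rightarrow> 'g set" where K: "\<And>n. compact (K n)" "incseq K" "(\<Union>n. K n) = UNIV"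
    using compact_exhaustion[OF locally_compact] by metis
  have [measurable]: "K n \<in> sets borel" for n using K(1) by (rule borel_compact)
  define A where "A n = {x \<in> space \<mu>. orbit_mass u x < \<infinity> \<and>
    orbit_mass u x < 2 * emeasure (orbit_measure u x) (K n)}" for n
  have A_sets [measurable]: "A n \<in> sets \<mu>" for n unfolding A_def by measurable
  have "\<exists>n. emeasure \<mu> (A n) > 0"
  proof (rule ccontr)
    assume "\<not> (\<exists>n. emeasure \<mu> (A n) > 0)"
    then have "AE x in \<mu>. x \<notin> A n" for n
      by (intro AE_not_in) (simp add: null_sets_def)
    then have "AE x in \<mu>. \<forall>n. x \<notin> A n" by (simp add: AE_all_countable)
    then have "AE x in \<mu>. \<not> (0 < orbit_mass u x \<and> orbit_mass u x < \<infinity>)"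
    proof (rule AE_mp, intro AE_I2 impI notI)
      fix x assume x: "x \<in> space \<mu>" and none: "\<forall>n. x \<notin> A n"
        and mass: "0 < orbit_mass u x \<and> orbit_mass u x < \<infinity>"
      have "(SUP n. emeasure (orbit_measure u x) (K n)) = orbit_mass u x"
        using SUP_emeasure_incseq[of K "orbit_measure u x"] K by (simp add: image_subset_iff)
      moreover have "orbit_mass u x / 2 < orbit_mass u x"
        using mass by (cases "orbit_mass u x")
          (auto simp: ennreal_divide_numeral ennreal_less_iff)
      ultimately obtain n where "orbit_mass u x / 2 < emeasure (orbit_measure u x) (K n)"
        by (metis less_SUP_iff)
      then have "x \<in> A n"
        using x mass by (simp add: A_def divide_less_ennreal mult.commute)
      with none show False by blast
    qed
    with pos show False by blast
  qed
  then obtain n where n: "emeasure \<mu> (A n) > 0" by blast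
  define L where "L = (\<lambda>p. - fst p + snd p) ` (K n \<times> K n)"
  have "compact L"
    unfolding L_def by (intro compact_continuous_image compact_Times K continuous_intros)
  moreover have "h \<in> L" if x: "x \<in> A n" and hx: "act h x \<in> A n" for h x
  proof (rule ccontr)
    assume "h \<notin> L"
    have sp: "x \<in> space \<mu>" using x by (simp add: A_def)
    let ?m = "emeasure (orbit_measure u x)" and ?K = "(\<lambda>g. g - h) -` K n"
    obtain k :: ennreal where k: "k \<noteq> 0" "k \<noteq> top"
      "\<And>E. E \<in> sets borel \<Longrightarrow> emeasure (orbit_measure u (act h x)) E =
       k * ?m ((\<lambda>g. g - h) -` E)"
      using orbit_measure_translate[OF assms(1) sp, of h] by metis
    have "k * ?m UNIV < k * (2 * ?m ?K)"
      using hx k(3)[of UNIV] k(3)[of "K n"] by (simp add: A_def mult.left_commute)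
    then have b: "?m UNIV < 2 * ?m ?K"
      by (metis mult_left_mono not_le zero_le)
    have a: "?m UNIV < 2 * ?m (K n)" and fin: "?m UNIV < \<infinity>" using x by (auto simp: A_def)
    have disj: "K n \<inter> ?K = {}"
    proof (rule ccontr)
      assume "K n \<inter> ?K \<noteq> {}"
      then obtain g where g: "g \<in> K n" "g - h \<in> K n" by blast
      have "h = - (g - h) + g" by (simp add: minus_diff_eq)
      then have "h \<in> L" using g unfolding L_def by force
      with \<open>h \<notin> L\<close> show False by blast
    qed
    have sub: "(\<lambda>g. g - h) \<in> borel \<rightarrow>\<^sub>M borel"
      unfolding diff_conv_add_uminus by measurable
    have K': "?K \<in> sets borel" using measurable_sets[OF sub, of "K n"] by simp
    have "?m (K n) + ?m ?K = ?m (K n \<union> ?K)"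
      using disj K' by (intro plus_emeasure) simp_all
    also have "\<dots> \<le> ?m UNIV" using K' by (intro emeasure_mono) simp_all
    finally have "2 * (?m (K n) + ?m ?K) \<le> 2 * ?m UNIV" by (rule mult_left_mono) simp
    moreover have "?m UNIV + ?m UNIV < 2 * ?m (K n) + 2 * ?m ?K"
      using a b by (rule add_strict_mono)
    ultimately show False
      by (simp add: distrib_left mult_2)
  qed
  ultimately have "transient (A n)" unfolding transient_def by blast
  with n show thesis using that A_sets by blast
qed

text \<open>
  By duality, the integral of the orbit mass over \<open>A\<close> is the integral of \<open>u\<close> against the time that
  an orbit of the inverse action spends in \<open>A\<close>.  Transience bounds this time uniformly: all times
  \<open>g\<close> with \<open>g\<^sup>-\<^sup>1.y \<in> A\<close> lie in the translate, by any one of them, of a fixed compact set.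
\<close>

lemma orbit_mass_finite_on_transient:
  assumes [measurable]: "u \<in> borel_measurable \<mu>" "A \<in> sets \<mu>"
    and fin: "(\<integral>\<^sup>+ x. u x \<partial>\<mu>) < \<infinity>" and "transient A"
  shows "AE x in \<mu>. x \<in> A \<longrightarrow> orbit_mass u x < \<infinity>"
proof -
  obtain L where L: "compact L" "\<And>g x. x \<in> A \<Longrightarrow> act g x \<in> A \<Longrightarrow> g \<in> L"
    using \<open>transient A\<close> unfolding transient_def by blast
  define L' where "L' = uminus ` L"
  have L': "compact L'"
    unfolding L'_def by (intro compact_continuous_image L continuous_intros)
  have occupation: "(\<integral>\<^sup>+ g. indicator A (act (- g) y) \<partial>\<eta>) \<le> emeasure \<eta> L'"
    if y: "y \<in> space \<mu>" for y
  proof (cases "\<exists>g0. act (- g0) y \<in> A")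
    case True
    then obtain g0 where g0: "act (- g0) y \<in> A" by blast
    let ?E = "(\<lambda>g. - g0 + g) -` L'"
    have E: "?E \<in> sets borel"
      using measurable_sets[of "\<lambda>g. - g0 + g" borel borel L'] borel_compact[OF L'] by simp
    have "g \<in> ?E" if g: "act (- g) y \<in> A" for g
    proof -
      have "act (- g + g0) (act (- g0) y) = act (- g) y"
        using y by (subst act_add[symmetric]) (simp_all add: add.assoc)
      then have "- g + g0 \<in> L" using L(2)[OF g0, of "- g + g0"] g by simp
      then have "- (- g + g0) \<in> L'" unfolding L'_def by blast
      then show ?thesis by (simp add: minus_add)
    qed
    then have "(\<integral>\<^sup>+ g. indicator A (act (- g) y) \<partial>\<eta>) \<le> (\<integral>\<^sup>+ g. indicator ?E g \<partial>\<eta>)"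
      by (intro nn_integral_mono) (auto simp: indicator_def)
    also have "\<dots> = emeasure \<eta> ?E" using E by simp
    also have "\<dots> = emeasure \<eta> L'"
      by (rule emeasure_vimage_translate[OF borel_compact[OF L']])
    finally show ?thesis .
  qed simp
  have "(\<integral>\<^sup>+ x. indicator A x * orbit_mass u x \<partial>\<mu>) =
      (\<integral>\<^sup>+ g. \<integral>\<^sup>+ y. indicator A (act (- g) y) * u y \<partial>\<mu> \<partial>\<eta>)"
    by (rule nn_integral_orbit_mass) measurable
  also have "\<dots> = (\<integral>\<^sup>+ y. \<integral>\<^sup>+ g. indicator A (act (- g) y) * u y \<partial>\<eta> \<partial>\<mu>)"
    by (rule pair.Fubini'[symmetric]) measurable
  also have "\<dots> = (\<integral>\<^sup>+ y. (\<integral>\<^sup>+ g. indicator A (act (- g) y) \<partial>\<eta>) * u y \<partial>\<mu>)"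
    by (intro nn_integral_cong nn_integral_multc) measurable
  also have "\<dots> \<le> (\<integral>\<^sup>+ y. emeasure \<eta> L' * u y \<partial>\<mu>)"
    using occupation by (intro nn_integral_mono mult_right_mono) simp_all
  also have "\<dots> = emeasure \<eta> L' * (\<integral>\<^sup>+ y. u y \<partial>\<mu>)" by (simp add: nn_integral_cmult)
  also have "\<dots> < \<infinity>" using fin compact_finite[OF L'] by (simp add: ennreal_mult_less_top)
  finally have "(\<integral>\<^sup>+ x. indicator A x * orbit_mass u x \<partial>\<mu>) \<noteq> \<infinity>" by simp
  then have "AE x in \<mu>. indicator A x * orbit_mass u x \<noteq> \<infinity>"
    by (intro nn_integral_PInf_AE) measurable
  then show ?thesis by eventually_elim (simp add: less_top split: split_indicator_asm)
qed

text \<open>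
  If \<open>A\<close> returns to itself only for a set of elements of finite Haar measure, then duality makes the
  orbit integral of a function supported on \<open>A\<close> finite almost everywhere on \<open>A\<close>.
\<close>

lemma transient_if_not_haar_recurrent:
  assumes A [measurable]: "A \<in> sets \<mu>" and pos: "emeasure \<mu> A > 0"
    and "\<not> poincare_haar_recurrent \<eta> act \<mu> A"
  obtains B where "B \<in> sets \<mu>" "emeasure \<mu> B > 0" "transient B"
proof -
  define R where "R = {g. emeasure \<mu> (A \<inter> act g ` A) > 0}"
  have R [measurable]: "R \<in> sets borel"
    unfolding R_def by (rule recurrence_set_measurable[OF G_space base.sigma_finite_measure_axioms A])
  have R_fin: "emeasure \<eta> R < \<infinity>"
    using assms(3) unfolding poincare_haar_recurrent_def R_def by (simp add: less_top)
  obtain h where h [measurable]: "h \<in> borel_measurable \<mu>" and h_fin: "integral\<^sup>N \<mu> h < \<infinity>"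
    and h_pos: "\<And>x. x \<in> space \<mu> \<Longrightarrow> 0 < h x"
    using base.Ex_finite_integrable_function by (auto simp: less_top)
  \<comment> \<open>The factor \<open>h\<close> makes \<open>u\<close> integrable although \<open>A\<close> may have infinite measure.\<close>
  define u where "u x = indicator A x * h x" for x
  have u [measurable]: "u \<in> borel_measurable \<mu>" unfolding u_def by measurable
  have inner: "(\<integral>\<^sup>+ y. indicator A (act (- g) y) * u y \<partial>\<mu>) \<le> indicator R g * integral\<^sup>N \<mu> h" for g
  proof (cases "g \<in> R")
    case True
    then show ?thesis by (auto simp: u_def indicator_def intro!: nn_integral_mono)
  next
    case False
    have "A \<inter> act g ` A \<in> sets \<mu>" using A borel_G_space_image_sets[OF G_space A] by blast
    then have "AE y in \<mu>. y \<notin> A \<inter> act g ` A"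
      using False by (intro AE_not_in) (simp add: R_def null_sets_def)
    then have "AE y in \<mu>. indicator A (act (- g) y) * u y = 0"
      by (rule AE_mp)
        (auto simp: u_def indicator_def borel_G_space_image_eq[OF G_space sets.sets_into_space[OF A]]
          intro!: AE_I2)
    then show ?thesis using False by (subst nn_integral_cong_AE) auto
  qed
  have "(\<integral>\<^sup>+ x. indicator A x * orbit_mass u x \<partial>\<mu>) =
      (\<integral>\<^sup>+ g. \<integral>\<^sup>+ y. indicator A (act (- g) y) * u y \<partial>\<mu> \<partial>\<eta>)"
    by (rule nn_integral_orbit_mass) measurable
  also have "\<dots> \<le> (\<integral>\<^sup>+ g. indicator R g * integral\<^sup>N \<mu> h \<partial>\<eta>)"
    by (intro nn_integral_mono inner)
  also have "\<dots> = emeasure \<eta> R * integral\<^sup>N \<mu> h" by (simp add: nn_integral_multc)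
  also have "\<dots> < \<infinity>" using R_fin h_fin by (simp add: ennreal_mult_less_top)
  finally have "(\<integral>\<^sup>+ x. indicator A x * orbit_mass u x \<partial>\<mu>) \<noteq> \<infinity>" by simp
  then have "AE x in \<mu>. indicator A x * orbit_mass u x \<noteq> \<infinity>"
    by (intro nn_integral_PInf_AE) measurable
  moreover have "AE x in \<mu>. u x > 0 \<longrightarrow> orbit_mass u x > 0"
    by (rule orbit_mass_positive[OF u])
  ultimately have on_A: "AE x in \<mu>. x \<in> A \<longrightarrow> 0 < orbit_mass u x \<and> orbit_mass u x < \<infinity>"
    using AE_space by eventually_elim (auto simp: less_top u_def h_pos)
  have "\<not> (AE x in \<mu>. \<not> (0 < orbit_mass u x \<and> orbit_mass u x < \<infinity>))"
  proof
    assume "AE x in \<mu>. \<not> (0 < orbit_mass u x \<and> orbit_mass u x < \<infinity>)"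
    with on_A have "AE x in \<mu>. x \<notin> A" by eventually_elim blast
    then show False using pos A by (simp add: AE_iff_null_sets[symmetric] null_sets_def)
  qed
  from transient_if_orbit_mass_finite[OF u this] show thesis using that by blast
qed

section \<open>Conservativity and recurrence\<close>

text \<open>
  If all orbit integrals are infinite almost everywhere, then the whole space and the empty set
  form a Hopf decomposition.
\<close>

lemma conservative_iff_orbit_integral_infinite:
  "conservative \<eta> act \<mu> \<rho> \<longleftrightarrow>
    (\<forall>f\<in>L1_plus \<mu>. AE x in \<mu>. orbit_integral \<eta> act \<rho> f x = \<infinity>)"
proof
  assume "conservative \<eta> act \<mu> \<rho>"
  then obtain C D where CD: "hopf_decomposition \<eta> act \<mu> \<rho> C D" "emeasure \<mu> D = 0"
    unfolding conservative_def by blast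
  then have "AE x in \<mu>. x \<notin> D"
    by (intro AE_not_in) (simp add: hopf_decomposition_def null_sets_def)
  then have "AE x in \<mu>. orbit_integral \<eta> act \<rho> f x = \<infinity>" if "f \<in> L1_plus \<mu>" for f
  proof -
    have "AE x in \<mu>. x \<in> D \<longleftrightarrow> orbit_integral \<eta> act \<rho> f x < \<infinity>"
      using CD(1) that unfolding hopf_decomposition_def by blast
    with \<open>AE x in \<mu>. x \<notin> D\<close> show ?thesis by eventually_elim (simp add: less_top[symmetric])
  qed
  then show "\<forall>f\<in>L1_plus \<mu>. AE x in \<mu>. orbit_integral \<eta> act \<rho> f x = \<infinity>" by blast
next
  assume inf: "\<forall>f\<in>L1_plus \<mu>. AE x in \<mu>. orbit_integral \<eta> act \<rho> f x = \<infinity>"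
  have "act g ` space \<mu> = space \<mu>" for g
    using borel_G_space_image_eq[OF G_space order_refl, of g] by auto
  moreover have "AE x in \<mu>. x \<in> space \<mu> \<longleftrightarrow> orbit_integral \<eta> act \<rho> f x = \<infinity>"
    and "AE x in \<mu>. x \<in> {} \<longleftrightarrow> orbit_integral \<eta> act \<rho> f x < \<infinity>" if "f \<in> L1_plus \<mu>" for f
    using inf[rule_format, OF that] AE_space[of \<mu>] by (eventually_elim, simp)+
  ultimately have "hopf_decomposition \<eta> act \<mu> \<rho> (space \<mu>) {}"
    by (simp add: hopf_decomposition_def G_invariant_def)
  then show "conservative \<eta> act \<mu> \<rho>"
    unfolding conservative_def by (intro exI conjI) auto
qed

lemma L1_plus_nonempty: "L1_plus \<mu> \<noteq> {}"
proof -
  obtain h where h [measurable]: "h \<in> borel_measurable \<mu>" and h_fin: "integral\<^sup>N \<mu> h \<noteq> \<infinity>"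
    and h_pos: "\<And>x. x \<in> space \<mu> \<Longrightarrow> 0 < h x \<and> h x < \<infinity>"
    using base.Ex_finite_integrable_function by blast
  have "(\<integral>\<^sup>+ x. ennreal (enn2real (h x)) \<partial>\<mu>) = integral\<^sup>N \<mu> h"
    using h_pos by (intro nn_integral_cong) simp
  then have "integrable \<mu> (\<lambda>x. enn2real (h x))"
    using h_fin by (intro integrableI_nonneg) (auto simp: less_top)
  then have "(\<lambda>x. enn2real (h x)) \<in> L1_plus \<mu>"
    using h_pos by (simp add: L1_plus_def enn2real_positive_iff)
  then show ?thesis by blast
qed

lemma conservative_no_transient:
  assumes "conservative \<eta> act \<mu> \<rho>" "A \<in> sets \<mu>" "transient A"
  shows "emeasure \<mu> A = 0"
proof -
  obtain f where f: "f \<in> L1_plus \<mu>" using L1_plus_nonempty by blast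
  then have int: "integrable \<mu> f" by (simp add: L1_plus_def)
  then have meas [measurable]: "f \<in> borel_measurable \<mu>" by simp
  have "(\<integral>\<^sup>+ x. ennreal (f x) \<partial>\<mu>) < \<infinity>"
    using integrableD(2)[OF int] by (simp add: less_top)
  then have "AE x in \<mu>. x \<in> A \<longrightarrow> orbit_mass (\<lambda>x. ennreal (f x)) x < \<infinity>"
    using assms(2,3) by (intro orbit_mass_finite_on_transient) simp_all
  moreover have "AE x in \<mu>. orbit_integral \<eta> act \<rho> f x = \<infinity>"
    using assms(1) f conservative_iff_orbit_integral_infinite by blast
  ultimately have "AE x in \<mu>. x \<notin> A"
    using AE_space by eventually_elim (auto simp: orbit_integral_eq_orbit_mass)
  then show ?thesis using assms(2) by (simp add: AE_iff_null_sets[symmetric] null_sets_def)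
qed

lemma conservative_if_recurrent:
  assumes "\<forall>A\<in>sets \<mu>. emeasure \<mu> A > 0 \<longrightarrow> poincare_recurrent act \<mu> A"
  shows "conservative \<eta> act \<mu> \<rho>"
  unfolding conservative_iff_orbit_integral_infinite
proof (rule ballI)
  fix f assume f: "f \<in> L1_plus \<mu>"
  then have meas [measurable]: "f \<in> borel_measurable \<mu>" by (auto simp: L1_plus_def)
  define u where "u x = ennreal (f x)" for x
  have u [measurable]: "u \<in> borel_measurable \<mu>" unfolding u_def by measurable
  have "AE x in \<mu>. \<not> (0 < orbit_mass u x \<and> orbit_mass u x < \<infinity>)"
  proof (rule ccontr)
    assume "\<not> ?thesis"
    then obtain A where "A \<in> sets \<mu>" "emeasure \<mu> A > 0" "transient A"
      using transient_if_orbit_mass_finite[OF u] by blast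
    then show False using assms transient_not_recurrent by blast
  qed
  moreover have "AE x in \<mu>. u x > 0 \<longrightarrow> orbit_mass u x > 0"
    by (rule orbit_mass_positive[OF u])
  ultimately show "AE x in \<mu>. orbit_integral \<eta> act \<rho> f x = \<infinity>"
    using AE_space
    by eventually_elim (use f in \<open>auto simp: orbit_integral_eq_orbit_mass u_def[abs_def] L1_plus_def less_top[symmetric]\<close>)
qed

lemma haar_recurrent_imp_recurrent:
  assumes "poincare_haar_recurrent \<eta> act \<mu> A"
  shows "poincare_recurrent act \<mu> A"
  unfolding poincare_recurrent_def
proof (intro allI impI, rule ccontr)
  fix K :: "'g set"
  assume K: "compact K" and "\<not> (\<exists>g. g \<notin> K \<and> emeasure \<mu> (A \<inter> act g ` A) > 0)"
  then have "{g. emeasure \<mu> (A \<inter> act g ` A) > 0} \<subseteq> K" by blast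
  then have "emeasure \<eta> {g. emeasure \<mu> (A \<inter> act g ` A) > 0} \<le> emeasure \<eta> K"
    using K by (intro emeasure_mono) (simp_all add: borel_compact)
  with compact_finite[OF K] assms show False
    by (simp add: poincare_haar_recurrent_def)
qed

end

theorem theoremB:
  fixes \<eta> :: "'g::{topological_group_add, t2_space, second_countable_topology} measure"
    and act :: "'g \<Rightarrow> 'x \<Rightarrow> 'x"
    and \<mu> :: "'x measure"
    and \<rho> :: "'g \<Rightarrow> 'x \<Rightarrow> real"
  assumes "locally_compact_space (euclidean :: 'g topology)"
    and "left_haar_measure \<eta>"
    and "nonsingular_G_space act \<mu>"
    and "radon_nikodym_cocycle act \<mu> \<rho>"
  shows "(conservative \<eta> act \<mu> \<rho> \<longleftrightarrow>
            (\<forall>A\<in>sets \<mu>. emeasure \<mu> A > 0 \<longrightarrow> poincare_recurrent act \<mu> A)) \<and>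
         ((\<forall>A\<in>sets \<mu>. emeasure \<mu> A > 0 \<longrightarrow> poincare_recurrent act \<mu> A) \<longleftrightarrow>
            (\<forall>A\<in>sets \<mu>. emeasure \<mu> A > 0 \<longrightarrow> poincare_haar_recurrent \<eta> act \<mu> A))"
proof -
  interpret nonsingular_action \<eta> act \<mu> \<rho>
    using assms by unfold_locales
  have "poincare_haar_recurrent \<eta> act \<mu> A"
    if cons: "conservative \<eta> act \<mu> \<rho>" and A: "A \<in> sets \<mu>" "emeasure \<mu> A > 0" for A
  proof (rule ccontr)
    assume "\<not> ?thesis"
    then obtain B where "B \<in> sets \<mu>" "emeasure \<mu> B > 0" "transient B"
      using transient_if_not_haar_recurrent[OF A] by blast
    with conservative_no_transient[OF cons] show False by simp
  qed
  with conservative_if_recurrent haar_recurrent_imp_recurrent show ?thesis by blast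
qed

end
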